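(* Let $N$ be a finite nonempty index set, let $n=|N|$, and let $$V=\operatorname{conv}\Bigl\{(x,y)\in\{0,1\}^{N}\times\{0,1\}^{n}:\ \sum_{j\in N}x_j=\sum_{k=1}^{n}k\,y_k,\ \ \sum_{k=1}^{n}y_k\le1\Bigr\}.$$ Then $V$ is a polytope whose affine hull is given by the equation $$\sum_{j\in N}x_j=\sum_{k=1}^{n}k\,y_k .$$ The facets of $V$ are given by $$\sum_{j\in T}x_j-\sum_{k=1}^{|T|}k\,y_k-\sum_{k=|T|+1}^{n}|T|\,y_k\le0\qquad\text{for }\emptyset\ne T\subset N,$$ $$\sum_{k=1}^{n}y_k\le1,$$ $$y_k\ge0\qquad\text{for }k=1,\dots,n.$$
   Context: The polytope $V$ is the linking polyhedron for a block $N$ of binary variables $x_j$ having identical constraint columns; it links these variables to new binary variables $y_1,\dots,y_n$, where $y_k=1$ indicates that exactly $k$ of the variables $x_j$ equal $1$ (and $y=0$ corresponds to $x=0$).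
   Formalization: For n=2 the inequality y_1≥0 is left out of the list of facets, since there V is a tetrahedron and y_1=0 meets it only in an edge; y_1≥0 remains in the linear description of V, and all other listed inequalities are shown to give facets. *)

theory Defs
  imports "HOL-Analysis.Analysis"
begin

text \<open>
  The block \<open>N\<close> is the finite type \<^typ>\<open>'a\<close>, so \<open>n = CARD('a)\<close>.  The coordinates of \<open>y\<close> are
  indexed by a type whose elements are exactly the numbers \<open>1, \<dots>, n\<close>, which makes the ambient
  space the Euclidean space \<open>real^'a \<times> real^'a level\<close> of dimension \<open>2n\<close>.
\<close>

typedef (overloaded) ('a::finite) level = "{1..CARD('a)}"
  morphisms level_to_nat nat_to_level
proof
  show "1 \<in> {1..CARD('a)}" by (simp add: Suc_le_eq)
qed

instance level :: (finite) finite
proof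
  have "(UNIV :: 'a level set) = nat_to_level ` {1..CARD('a)}"
    using type_definition.Abs_image[OF type_definition_level] by metis
  then show "finite (UNIV :: 'a level set)"
    by (metis finite_atLeastAtMost finite_imageI)
qed

text \<open>The coordinate \<open>y\<^sub>k\<close>; only meaningful for \<open>1 \<le> k \<le> CARD('a)\<close>.\<close>

definition yc :: "real ^ ('a::finite) level \<Rightarrow> nat \<Rightarrow> real" where
  "yc y k = y $ nat_to_level k"

definition linking_points :: "((real ^ 'a::finite) \<times> (real ^ 'a level)) set" where
  "linking_points =
    {(x, y). (\<forall>j. x $ j \<in> {0, 1}) \<and> (\<forall>k\<in>{1..CARD('a)}. yc y k \<in> {0, 1})
      \<and> (\<Sum>j\<in>UNIV. x $ j) = (\<Sum>k=1..CARD('a). real k * yc y k)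
      \<and> (\<Sum>k=1..CARD('a). yc y k) \<le> 1}"

definition linking_polyhedron :: "((real ^ 'a::finite) \<times> (real ^ 'a level)) set" where
  "linking_polyhedron = convex hull linking_points"

definition subset_form :: "'a set \<Rightarrow> (real ^ 'a::finite) \<Rightarrow> (real ^ 'a level) \<Rightarrow> real" where
  "subset_form T x y =
    (\<Sum>j\<in>T. x $ j) - (\<Sum>k=1..card T. real k * yc y k)
      - (\<Sum>k=card T + 1..CARD('a). real (card T) * yc y k)"

text \<open>
  Indices \<open>k\<close> for which \<open>y\<^sub>k \<ge> 0\<close> defines a facet of the linking polyhedron in dimension
  parameter \<open>n\<close>.  All of \<open>1, \<dots>, n\<close> qualify, with a single exception: for \<open>n = 2\<close> the polyhedron
  is a tetrahedron with the four facets \<open>x\<^sub>1 \<le> y\<^sub>1 + y\<^sub>2\<close>, \<open>x\<^sub>2 \<le> y\<^sub>1 + y\<^sub>2\<close>, \<open>y\<^sub>1 + y\<^sub>2 \<le> 1\<close>, \<open>y\<^sub>2 \<ge> 0\<close>.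
  Adding the first two and using \<open>x\<^sub>1 + x\<^sub>2 = y\<^sub>1 + 2 y\<^sub>2\<close> gives \<open>y\<^sub>1 \<ge> 0\<close>, which is tight only on
  an edge.
\<close>

definition nonneg_facet_indices :: "nat \<Rightarrow> nat set" where
  "nonneg_facet_indices n = (if n = 2 then {2} else {1..n})"

end

theory Submission
  imports Defs
begin

text \<open>
  The integer points that span \<open>V\<close> correspond to the subsets \<open>A\<close> of \<open>N\<close>: \<open>x\<close> is the indicator vector of
  \<open>A\<close>, and \<open>y\<close> is the unit vector with index \<open>|A|\<close> (zero for \<open>A = \<emptyset>\<close>).  At the point of \<open>A\<close> the form
  of \<open>T\<close> takes the value \<open>|A \<inter> T| - min |A| |T|\<close>, so it is at most 0, and it is 0 exactly when
  \<open>A \<subseteq> T\<close> or \<open>T \<subseteq> A\<close>.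

  The inequalities suffice because, for fixed \<open>y\<close>, they bound \<open>x(T)\<close> by the submodular function
  \<open>\<Sum>\<^sub>k y\<^sub>k min k |T|\<close>, with equality for \<open>T = N\<close>, and linear optimization over such a base polytope is
  solved by the greedy algorithm.  Concretely, a point outside \<open>V\<close> that satisfies the system would be
  separated from \<open>V\<close> by a linear functional; sorting \<open>N\<close> by its \<open>x\<close>-coefficients, the convex combination
  with weights \<open>y\<^sub>k\<close> of the points of the initial segments of length \<open>k\<close> has the same \<open>y\<close>-part, and
  summation by parts (\<open>sum_antitone_weights_nonpos\<close>) shows that the functional does not separate it from
  the given point.  This is \<open>linking_polyhedronI\<close>.

  For the affine hull and the facets no dimension is computed.  The hyperplane of the equation is spanned
  by the differences \<open>(e\<^sub>i - e\<^sub>j, 0)\<close> together with one point \<open>(x, e\<^sub>k)\<close> for each level \<open>k\<close>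
  (\<open>cardinality_hyperplane_subset_span\<close>).  Each listed inequality is tight on so many points that a single
  further one makes the spanning set complete, so its face has codimension one in \<open>V\<close>
  (\<open>tight_set_facet_of\<close>).  Conversely, a facet of a polyhedron lies in the tight set of one of the
  inequalities that describe it, and equals that set when the set is a facet itself
  (\<open>facets_of_facet_system\<close>).
\<close>

section \<open>Facets of a polyhedron\<close>

lemma tight_set_face_of:
  fixes f :: "'v::euclidean_space \<Rightarrow> real"
  assumes "convex V" "linear f" "\<And>p. p \<in> V \<Longrightarrow> f p \<le> b"
  shows "V \<inter> {p. f p = b} face_of V"
proof -
  have f: "f p = adjoint f 1 \<bullet> p" for p
    using adjoint_works[OF assms(2), of p 1] by (simp add: inner_commute)
  have "V \<inter> {p. adjoint f 1 \<bullet> p = b} face_of V"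
    using assms f by (intro face_of_Int_supporting_hyperplane_le) auto
  then show ?thesis by (simp add: f)
qed

text \<open>
  A criterion that avoids dimensions: adjoining one point raises the affine dimension by at most one,
  whereas a proper face has strictly smaller dimension.
\<close>

lemma tight_set_facet_of:
  fixes f :: "'v::euclidean_space \<Rightarrow> real"
  assumes V: "convex V" "linear f" "\<And>p. p \<in> V \<Longrightarrow> f p \<le> b"
    and q: "q \<in> V" "f q \<noteq> b"
    and ne: "V \<inter> {p. f p = b} \<noteq> {}"
    and hull: "V \<subseteq> affine hull (insert q (V \<inter> {p. f p = b}))"
  shows "V \<inter> {p. f p = b} facet_of V"
proof -
  let ?G = "V \<inter> {p. f p = b}"
  have face: "?G face_of V"
    using V by (rule tight_set_face_of)
  have "?G \<noteq> V" using q by auto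
  then have lt: "aff_dim ?G < aff_dim V"
    using face V(1) by (intro face_of_aff_dim_lt)
  have "aff_dim V \<le> aff_dim (insert q ?G)"
    using aff_dim_subset[OF hull] by (simp add: aff_dim_affine_hull)
  also have "\<dots> \<le> aff_dim ?G + 1"
    by (simp add: aff_dim_insert)
  finally show ?thesis
    using lt face ne by (simp add: facet_of_def)
qed

text \<open>
  A relative interior point of a facet \<open>F\<close> must make some inequality tight, as otherwise it would lie in
  the relative interior of \<open>V\<close>.  Then \<open>F\<close> is a face of the tight set, and since both have the same
  dimension they agree.  Assuming that every tight set is a facet takes the place of irredundancy of the
  system; it allows several inequalities to define the same facet.
\<close>

lemma facets_of_facet_system:
  fixes V :: "'v::euclidean_space set" and L :: "(('v \<Rightarrow> real) \<times> real) set"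
  assumes cV: "convex V" and fin: "finite L"
    and lin: "\<And>f b. (f, b) \<in> L \<Longrightarrow> linear f"
    and desc: "V = affine hull V \<inter> {p. \<forall>(f, b) \<in> L. f p \<le> b}"
    and facet: "\<And>f b. (f, b) \<in> L \<Longrightarrow> V \<inter> {p. f p = b} facet_of V"
  shows "{F. F facet_of V} = (\<lambda>(f, b). V \<inter> {p. f p = b}) ` L"
proof (intro equalityI subsetI)
  fix F assume "F \<in> {F. F facet_of V}"
  then have F: "F facet_of V" by simp
  then have Fface: "F face_of V" and "F \<noteq> {}" and Fdim: "aff_dim F = aff_dim V - 1"
    by (auto simp: facet_of_def)
  have cF: "convex F"
    using Fface by (rule face_of_imp_convex)
  obtain p where p: "p \<in> rel_interior F"
    using cF \<open>F \<noteq> {}\<close> rel_interior_eq_empty by blast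
  then have pF: "p \<in> F" using rel_interior_subset by blast
  then have pV: "p \<in> V" using Fface face_of_imp_subset by blast
  have "F \<noteq> V" using Fdim by auto
  have "\<exists>(f, b) \<in> L. f p = b"
  proof (rule ccontr)
    assume "\<not> ?thesis"
    moreover have "\<forall>(f, b) \<in> L. f p \<le> b" using pV desc by blast
    ultimately have strict: "\<forall>(f, b) \<in> L. f p < b" by force
    define U where "U = (\<Inter>(f, b) \<in> L. {q. f q < b})"
    have "open U"
      unfolding U_def
    proof (intro open_INT fin ballI)
      fix x assume "x \<in> L"
      then obtain f b where x: "x = (f, b)" "linear f" using lin by (cases x) auto
      have "continuous_on UNIV f" using x(2) by (simp add: linear_continuous_on linear_conv_bounded_linear)
      then show "open (case x of (f, b) \<Rightarrow> {q. f q < b})"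
        using x by (auto intro!: open_Collect_less continuous_on_const)
    qed
    moreover have "p \<in> U" using strict by (auto simp: U_def)
    moreover have "U \<inter> affine hull V \<subseteq> V"
    proof
      fix q assume q: "q \<in> U \<inter> affine hull V"
      then have "\<forall>(f, b) \<in> L. f q \<le> b" by (fastforce simp: U_def)
      then show "q \<in> V" using q by (subst desc) blast
    qed
    ultimately have "p \<in> rel_interior V"
      using pV by (auto simp: mem_rel_interior)
    then show False
      using face_of_disjoint_rel_interior[OF Fface \<open>F \<noteq> V\<close>] pF by blast
  qed
  then obtain f b where fb: "(f, b) \<in> L" "f p = b" by auto
  let ?G = "V \<inter> {p. f p = b}"
  have G: "?G facet_of V" using facet fb(1) by blast
  then have Gface: "?G face_of V" and Gdim: "aff_dim ?G = aff_dim V - 1"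
    by (auto simp: facet_of_def)
  have "F \<subseteq> ?G"
    using Gface face_of_imp_subset[OF Fface] p pV fb(2)
    by (intro subset_of_face_of[of ?G V F]) auto
  then have "F face_of ?G"
    using Fface Gface by (meson face_of_face face_of_imp_subset face_of_subset)
  then have "F = ?G"
    using face_of_aff_dim_lt[of ?G F] face_of_imp_convex[OF Gface] Fdim Gdim by fastforce
  then show "F \<in> (\<lambda>(f, b). V \<inter> {p. f p = b}) ` L"
    using fb(1) by (intro image_eqI[of _ _ "(f, b)"]) simp_all
qed (use facet in auto)

section \<open>Vertices of the linking polyhedron\<close>

lemma level_to_nat_nat_to_level:
  assumes "k \<in> {1..CARD('a::finite)}"
  shows "level_to_nat (nat_to_level k :: 'a level) = k"
  using assms by (rule nat_to_level_inverse)

lemma level_to_nat_bounds: "level_to_nat (l :: 'a::finite level) \<in> {1..CARD('a)}"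
  by (rule level_to_nat)

lemma yc_level_to_nat: "yc y (level_to_nat l) = y $ l"
  by (simp add: yc_def level_to_nat_inverse)

lemma yc_scaleR [simp]: "yc (r *\<^sub>R y) k = r * yc y k"
  and yc_add [simp]: "yc (y + y') k = yc y k + yc y' k"
  and yc_0 [simp]: "yc 0 k = 0"
  and yc_sum [simp]: "yc (\<Sum>i\<in>I. g i) k = (\<Sum>i\<in>I. yc (g i) k)"
  by (simp_all add: yc_def)

lemma yc_ext:
  fixes y z :: "real ^ 'a::finite level"
  assumes "\<And>k. k \<in> {1..CARD('a)} \<Longrightarrow> yc y k = yc z k"
  shows "y = z"
  using assms level_to_nat_bounds by (metis vec_eq_iff yc_level_to_nat)

text \<open>
  Since \<open>level_to_nat\<close> never takes the value 0, the second component is 0 for \<open>A = {}\<close> without a case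
  distinction.
\<close>

definition vertex :: "'a set \<Rightarrow> (real ^ 'a::finite) \<times> (real ^ 'a level)" where
  "vertex A = (\<chi> j. if j \<in> A then 1 else 0, \<chi> l. if level_to_nat l = card A then 1 else 0)"

lemma fst_vertex: "fst (vertex A) $ j = (if j \<in> A then 1 else 0)"
  by (simp add: vertex_def)

lemma yc_vertex:
  fixes A :: "'a::finite set"
  assumes "k \<in> {1..CARD('a)}"
  shows "yc (snd (vertex A)) k = (if k = card A then 1 else 0)"
  using assms by (simp add: vertex_def yc_def level_to_nat_nat_to_level)

lemma vertex_empty: "vertex {} = 0"
proof -
  have "level_to_nat l \<noteq> 0" for l :: "'a level"
    using level_to_nat_bounds[of l] by simp
  then show ?thesis by (simp add: vertex_def zero_prod_def vec_eq_iff)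
qed

lemma sum_fst_vertex: "(\<Sum>j\<in>T. fst (vertex A) $ j) = real (card (A \<inter> T))"
  for A T :: "'a::finite set"
  by (simp add: fst_vertex sum.If_cases Int_commute)

lemma sum_yc_vertex:
  fixes A :: "'a::finite set" and w :: "nat \<Rightarrow> real"
  assumes "w 0 = 0"
  shows "(\<Sum>k=1..CARD('a). w k * yc (snd (vertex A)) k) = w (card A)"
proof -
  have "(\<Sum>k=1..CARD('a). w k * yc (snd (vertex A)) k)
      = (\<Sum>k=1..CARD('a). if k = card A then w k else 0)"
    by (intro sum.cong) (auto simp: yc_vertex)
  also have "\<dots> = w (card A)"
    using assms card_mono[of UNIV A] by (cases "card A") auto
  finally show ?thesis .
qed

lemma linking_points_eq: "linking_points = range (vertex :: 'a::finite set \<Rightarrow> _)"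
proof (intro equalityI subsetI)
  fix p :: "(real ^ 'a) \<times> (real ^ 'a level)"
  assume "p \<in> linking_points"
  then obtain x y where p: "p = (x, y)" and x: "\<And>j. x $ j \<in> {0, 1}"
    and y: "\<And>k. k \<in> {1..CARD('a)} \<Longrightarrow> yc y k \<in> {0, 1}"
    and eq: "(\<Sum>j\<in>UNIV. x $ j) = (\<Sum>k=1..CARD('a). real k * yc y k)"
    and le: "(\<Sum>k=1..CARD('a). yc y k) \<le> 1"
    unfolding linking_points_def by blast
  define A where "A = {j. x $ j = 1}"
  have xA: "x $ j = (if j \<in> A then 1 else 0)" for j
    using x[of j] by (auto simp: A_def)
  have cA: "(\<Sum>j\<in>UNIV. x $ j) = real (card A)"
    by (simp add: xA sum.If_cases)
  \<comment> \<open>A 0/1 vector with entry sum at most 1 is zero or a unit vector; the equation determines the level.\<close>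
  have yA: "yc y k = (if k = card A then 1 else 0)" if k: "k \<in> {1..CARD('a)}" for k
  proof (cases "\<exists>m \<in> {1..CARD('a)}. yc y m = 1")
    case True
    then obtain m where m: "m \<in> {1..CARD('a)}" "yc y m = 1" by blast
    have zero: "yc y i = 0" if i: "i \<in> {1..CARD('a)} - {m}" for i
    proof -
      have "(\<Sum>k=1..CARD('a). yc y k) = yc y m + (\<Sum>k\<in>{1..CARD('a)} - {m}. yc y k)"
        using m(1) by (simp add: sum.remove)
      moreover have "yc y i \<le> (\<Sum>k\<in>{1..CARD('a)} - {m}. yc y k)"
        using i y by (intro member_le_sum) force+
      ultimately have "yc y i \<le> 0" using le m(2) by linarith
      then show ?thesis using y[of i] i by auto
    qed
    have "(\<Sum>k=1..CARD('a). real k * yc y k)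
        = real m * yc y m + (\<Sum>k\<in>{1..CARD('a)} - {m}. real k * yc y k)"
      using m(1) by (simp add: sum.remove)
    also have "\<dots> = real m" using zero m(2) by simp
    finally have "m = card A" using eq cA by simp
    then show ?thesis using m zero k by auto
  next
    case False
    then have "\<forall>m\<in>{1..CARD('a)}. yc y m = 0" using y by auto
    then show ?thesis using eq cA k by auto
  qed
  have "p = vertex A"
    unfolding p vertex_def
    by (auto simp: vec_eq_iff xA simp flip: yA[OF level_to_nat_bounds] simp: yc_level_to_nat)
  then show "p \<in> range vertex" by blast
next
  fix p :: "(real ^ 'a) \<times> (real ^ 'a level)"
  assume "p \<in> range vertex"
  then obtain A :: "'a set" where p: "p = vertex A" by blast
  have "(\<Sum>k=1..CARD('a). yc (snd (vertex A)) k) \<le> 1"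
    using sum_yc_vertex[of "\<lambda>k. if k = 0 then 0 else 1" A] by (simp split: if_splits)
  moreover have "(\<Sum>k=1..CARD('a). real k * yc (snd (vertex A)) k) = real (card A)"
    using sum_yc_vertex[of real A] by simp
  moreover have "(\<Sum>j\<in>UNIV. fst (vertex A) $ j) = real (card A)"
    using sum_fst_vertex[of A UNIV] by simp
  ultimately show "p \<in> linking_points"
    unfolding linking_points_def p by (auto simp: yc_vertex fst_vertex case_prod_beta)
qed

text \<open>
  The uniform coefficients \<open>min k |T|\<close> show that \<open>subset_form T\<close> compares \<open>x(T)\<close> with the largest value that a
  combination of \<open>k\<close>-sets with weights \<open>y\<^sub>k\<close> can put on \<open>T\<close>.
\<close>

lemma subset_form_min:
  fixes T :: "'a::finite set"
  shows "subset_form T x y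
    = (\<Sum>j\<in>T. x $ j) - (\<Sum>k=1..CARD('a). real (min k (card T)) * yc y k)"
proof -
  have "card T \<le> CARD('a)" by (simp add: card_mono)
  then have "{1..CARD('a)} = {1..card T} \<union> {card T + 1..CARD('a)}" by auto
  then have "(\<Sum>k=1..CARD('a). real (min k (card T)) * yc y k)
    = (\<Sum>k=1..card T. real (min k (card T)) * yc y k)
      + (\<Sum>k=card T + 1..CARD('a). real (min k (card T)) * yc y k)"
    by (simp add: sum.union_disjoint)
  moreover have "(\<Sum>k=1..card T. real (min k (card T)) * yc y k) = (\<Sum>k=1..card T. real k * yc y k)"
    by (intro sum.cong) auto
  moreover have "(\<Sum>k=card T + 1..CARD('a). real (min k (card T)) * yc y k)
    = (\<Sum>k=card T + 1..CARD('a). real (card T) * yc y k)"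
    by (intro sum.cong) auto
  ultimately show ?thesis unfolding subset_form_def by linarith
qed

lemma subset_form_vertex:
  "subset_form T (fst (vertex A)) (snd (vertex A)) = real (card (A \<inter> T)) - real (min (card A) (card T))"
  unfolding subset_form_min sum_fst_vertex
  using sum_yc_vertex[of "\<lambda>k. real (min k (card T))" A] by simp

section \<open>The linear description\<close>

definition cardinality_form :: "(real ^ 'a::finite) \<times> (real ^ 'a level) \<Rightarrow> real" where
  "cardinality_form p = (\<Sum>j\<in>UNIV. fst p $ j) - (\<Sum>k=1..CARD('a). real k * yc (snd p) k)"

lemma linear_cardinality_form: "linear cardinality_form"
  by (intro linearI)
    (simp_all add: cardinality_form_def sum.distrib sum_distrib_left algebra_simps)

lemma linear_subset_form: "linear (\<lambda>p. subset_form T (fst p) (snd p))"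
  by (intro linearI)
    (simp_all add: subset_form_min sum.distrib sum_distrib_left algebra_simps)

lemma linear_sum_yc: "linear (\<lambda>p. \<Sum>k\<in>K. yc (snd p) k)"
  by (intro linearI) (simp_all add: sum.distrib sum_distrib_left)

lemma linear_minus_yc: "linear (\<lambda>p. - yc (snd p) k)"
  by (intro linearI) (simp_all add: algebra_simps)

lemma vertex_in_linking_polyhedron: "vertex A \<in> linking_polyhedron"
  unfolding linking_polyhedron_def linking_points_eq by (rule hull_inc) simp

lemma polytope_linking_polyhedron: "polytope linking_polyhedron"
  unfolding linking_polyhedron_def linking_points_eq polytope_def
  by (metis finite_class.finite_UNIV finite_imageI)

lemma linking_polyhedron_le:
  fixes f :: "(real ^ 'a::finite) \<times> (real ^ 'a level) \<Rightarrow> real"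
  assumes "linear f" "\<And>A. f (vertex A) \<le> b" "p \<in> linking_polyhedron"
  shows "f p \<le> b"
proof -
  have "convex {p. f p \<le> b}"
    using assms(1) by (auto simp: convex_def linear_add linear_scale intro: convex_bound_le)
  then have "linking_polyhedron \<subseteq> {p. f p \<le> b}"
    unfolding linking_polyhedron_def linking_points_eq
    using assms(2) by (intro hull_minimal) auto
  then show ?thesis using assms(3) by blast
qed

lemma cardinality_form_vertex: "cardinality_form (vertex A) = 0"
  using sum_yc_vertex[of real A] sum_fst_vertex[of A UNIV] by (simp add: cardinality_form_def)

lemma linking_polyhedron_valid:
  fixes p :: "(real ^ 'a::finite) \<times> (real ^ 'a level)"
  assumes p: "p \<in> linking_polyhedron"
  shows "cardinality_form p = 0"
    and "subset_form T (fst p) (snd p) \<le> 0"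
    and "(\<Sum>k=1..CARD('a). yc (snd p) k) \<le> 1"
    and "k \<in> {1..CARD('a)} \<Longrightarrow> yc (snd p) k \<ge> 0"
proof -
  have "cardinality_form p \<le> 0"
    using linking_polyhedron_le[OF linear_cardinality_form, of 0 p] p by (simp add: cardinality_form_vertex)
  moreover have "- cardinality_form p \<le> 0"
    using linking_polyhedron_le[OF linear_compose_neg[OF linear_cardinality_form], of 0 p] p
    by (simp add: cardinality_form_vertex)
  ultimately show "cardinality_form p = 0" by simp
  have "card (A \<inter> T) \<le> min (card A) (card T)" for A
    by (simp add: card_mono)
  then show "subset_form T (fst p) (snd p) \<le> 0"
    by (intro linking_polyhedron_le[OF linear_subset_form _ p]) (simp add: subset_form_vertex)
  have "(\<Sum>k=1..CARD('a). yc (snd (vertex A)) k) \<le> 1" for A :: "'a set"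
    using sum_yc_vertex[of "\<lambda>k. if k = 0 then 0 else 1" A] by (simp split: if_splits)
  then show "(\<Sum>k=1..CARD('a). yc (snd p) k) \<le> 1"
    by (intro linking_polyhedron_le[OF linear_sum_yc _ p])
  assume k: "k \<in> {1..CARD('a)}"
  have "- yc (snd p) k \<le> 0"
    by (intro linking_polyhedron_le[OF linear_minus_yc _ p]) (simp add: yc_vertex[OF k])
  then show "yc (snd p) k \<ge> 0" by simp
qed

text \<open>
  Summation by parts: the sum is a combination of the partial sums of \<open>g\<close> with the coefficients
  \<open>u i - u (i + 1) \<ge> 0\<close>, apart from the last coefficient, which may have any sign but multiplies the
  vanishing total.
\<close>

lemma sum_antitone_weights_nonpos:
  fixes u g :: "nat \<Rightarrow> real"
  assumes anti: "\<And>i. Suc i < n \<Longrightarrow> u (Suc i) \<le> u i"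
    and partial: "\<And>m. m < n \<Longrightarrow> (\<Sum>i<m. g i) \<le> 0"
    and total: "(\<Sum>i<n. g i) = 0"
  shows "(\<Sum>i<n. u i * g i) \<le> 0"
proof -
  have *: "(\<Sum>i<Suc m. u i * g i) \<le> u m * (\<Sum>i<Suc m. g i)" if "m < n" for m
    using that
  proof (induction m)
    case (Suc m)
    have "u m * (\<Sum>i<Suc m. g i) \<le> u (Suc m) * (\<Sum>i<Suc m. g i)"
      using anti[of m] partial[of "Suc m"] Suc.prems by (intro mult_right_mono_neg) auto
    then show ?case using Suc by (simp add: algebra_simps)
  qed simp
  show ?thesis
  proof (cases n)
    case (Suc m)
    then show ?thesis using *[of m] total by simp
  qed simp
qed

lemma ex_sorting_enumeration:
  fixes c :: "'a::finite \<Rightarrow> real"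
  obtains e :: "nat \<Rightarrow> 'a" where "bij_betw e {..<CARD('a)} UNIV"
    "\<And>i. Suc i < CARD('a) \<Longrightarrow> c (e i) \<le> c (e (Suc i))"
proof -
  obtain xs0 :: "'a list" where xs0: "set xs0 = UNIV" "distinct xs0"
    using finite_distinct_list[OF finite_class.finite_UNIV] by blast
  define xs where "xs = sort_key c xs0"
  have xs: "set xs = UNIV" "distinct xs" "sorted (map c xs)"
    using xs0 by (simp_all add: xs_def)
  have len: "length xs = CARD('a)" using xs distinct_card by metis
  have "bij_betw ((!) xs) {..<CARD('a)} UNIV"
    using bij_betw_nth[OF xs(2) refl refl] xs(1) len by (simp add: atLeast0LessThan)
  moreover have "c (xs ! i) \<le> c (xs ! Suc i)" if "Suc i < CARD('a)" for i
    using sorted_nth_mono[OF xs(3), of i "Suc i"] that len by simp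
  ultimately show ?thesis by (rule that)
qed

text \<open>
  The greedy argument.  The point \<open>q\<close> built from the initial segments \<open>S k\<close> of the sorted set attains with
  equality the bounds that the system imposes on \<open>x(S m)\<close>, which makes it optimal for the separating
  functional among all points with the given \<open>y\<close>.
\<close>

lemma linking_polyhedronI:
  fixes x :: "real ^ 'a::finite" and y :: "real ^ 'a level"
  assumes eq: "cardinality_form (x, y) = 0"
    and T: "\<And>T. T \<noteq> {} \<Longrightarrow> T \<subset> UNIV \<Longrightarrow> subset_form T x y \<le> 0"
    and le1: "(\<Sum>k=1..CARD('a). yc y k) \<le> 1"
    and pos: "\<And>k. k \<in> {1..CARD('a)} \<Longrightarrow> yc y k \<ge> 0"
  shows "(x, y) \<in> linking_polyhedron"
proof (rule ccontr)
  let ?n = "CARD('a)"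
  assume nin: "(x, y) \<notin> linking_polyhedron"
  have conv: "convex linking_polyhedron" and clos: "closed linking_polyhedron"
    using polytope_linking_polyhedron polytope_imp_convex polytope_imp_closed by blast+
  obtain a b where ab: "a \<bullet> (x, y) < b" "\<And>p. p \<in> linking_polyhedron \<Longrightarrow> a \<bullet> p > b"
    using separating_hyperplane_closed_point[OF conv clos nin] by blast
  define c where "c = fst a"
  obtain e :: "nat \<Rightarrow> 'a" where e: "bij_betw e {..<?n} UNIV"
    and sorted: "\<And>i. Suc i < ?n \<Longrightarrow> c $ e i \<le> c $ e (Suc i)"
    using ex_sorting_enumeration[of "\<lambda>j. c $ j"] by blast
  define S where "S m = e ` {..<m}" for m
  have inj: "inj_on e {..<m}" if "m \<le> ?n" for m
    using e that by (auto simp: bij_betw_def intro: inj_on_subset)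
  have cardS: "card (S m) = m" if "m \<le> ?n" for m
    using inj[OF that] by (simp add: S_def card_image)
  have cardS_Int: "card (S k \<inter> S m) = min k m" if "k \<le> ?n" "m \<le> ?n" for k m
  proof -
    have "S k \<inter> S m = S (min k m)"
      by (cases "k \<le> m") (auto simp: S_def min_def)
    then show ?thesis using cardS that by simp
  qed
  \<comment> \<open>The weight left over by \<open>y\<close> goes to the vertex of the empty set, which is the origin.\<close>
  define q where
    "q = (1 - (\<Sum>k=1..?n. yc y k)) *\<^sub>R vertex {} + (\<Sum>k=1..?n. yc y k *\<^sub>R vertex (S k))"
  have q_eq: "q = (\<Sum>k=1..?n. yc y k *\<^sub>R vertex (S k))"
    by (simp add: q_def vertex_empty)
  have "q \<in> linking_polyhedron"
  proof -
    define w where "w k = (if k = 0 then 1 - (\<Sum>k=1..?n. yc y k) else yc y k)" for k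
    have split: "{0..?n} = insert 0 {1..?n}" by auto
    have "(\<Sum>k\<in>{0..?n}. w k *\<^sub>R vertex (S k)) \<in> linking_polyhedron"
      using conv le1 pos
      by (intro convex_sum) (auto simp: w_def split vertex_in_linking_polyhedron)
    moreover have "(\<Sum>k\<in>{0..?n}. w k *\<^sub>R vertex (S k)) = q"
      unfolding split by (simp add: w_def q_def S_def)
    ultimately show ?thesis by simp
  qed
  have snd_q: "snd q = y"
  proof (rule yc_ext)
    fix k assume k: "k \<in> {1..?n}"
    have "yc (snd q) k = (\<Sum>m=1..?n. yc y m * yc (snd (vertex (S m))) k)"
      by (simp add: q_eq snd_sum)
    also have "\<dots> = (\<Sum>m=1..?n. if m = k then yc y m else 0)"
      using k by (intro sum.cong) (auto simp: yc_vertex cardS)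
    also have "\<dots> = yc y k" using k by simp
    finally show "yc (snd q) k = yc y k" .
  qed
  have sum_q: "(\<Sum>j\<in>S m. fst q $ j) = (\<Sum>k=1..?n. real (min k m) * yc y k)" if m: "m \<le> ?n" for m
  proof -
    have "(\<Sum>j\<in>S m. fst q $ j) = (\<Sum>j\<in>S m. \<Sum>k=1..?n. yc y k * fst (vertex (S k)) $ j)"
      by (simp add: q_eq fst_sum)
    also have "\<dots> = (\<Sum>k=1..?n. yc y k * (\<Sum>j\<in>S m. fst (vertex (S k)) $ j))"
      by (subst sum.swap) (simp add: sum_distrib_left)
    also have "\<dots> = (\<Sum>k=1..?n. real (min k m) * yc y k)"
      using m by (intro sum.cong) (auto simp: sum_fst_vertex cardS_Int)
    finally show ?thesis .
  qed
  define g where "g i = x $ e i - fst q $ e i" for i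
  have partial_eq: "(\<Sum>i<m. g i) = (\<Sum>j\<in>S m. x $ j) - (\<Sum>k=1..?n. real (min k m) * yc y k)"
    if m: "m \<le> ?n" for m
  proof -
    have "(\<Sum>i<m. g i) = (\<Sum>j\<in>S m. x $ j - fst q $ j)"
      unfolding S_def by (simp add: sum.reindex[OF inj[OF m]] g_def)
    then show ?thesis by (simp add: sum_subtractf sum_q[OF m])
  qed
  have partial: "(\<Sum>i<m. g i) \<le> 0" if m: "m < ?n" for m
  proof (cases "m = 0")
    case False
    have cm: "card (S m) = m" using cardS m by simp
    have "S m \<noteq> {}" using False by (auto simp: S_def)
    moreover have "S m \<noteq> UNIV"
      using cm m by force
    ultimately have "subset_form (S m) x y \<le> 0" using T by blast
    then show ?thesis using partial_eq[of m] m by (simp add: subset_form_min cm)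
  qed simp
  have "S ?n = UNIV" using e by (simp add: S_def bij_betw_def)
  moreover have "(\<Sum>k=1..?n. real (min k ?n) * yc y k) = (\<Sum>k=1..?n. real k * yc y k)"
    by (intro sum.cong) auto
  ultimately have total: "(\<Sum>i<?n. g i) = 0"
    using partial_eq[of ?n] eq by (simp add: cardinality_form_def)
  \<comment> \<open>Points of the polyhedron have larger values of \<open>a\<close>, so the greedy order is ascending in \<open>c\<close> and the
    antitone weights are \<open>- c\<close>.\<close>
  have "(\<Sum>i<?n. (- c $ e i) * g i) \<le> 0"
    using sorted partial total by (intro sum_antitone_weights_nonpos) auto
  also have "(\<Sum>i<?n. (- c $ e i) * g i) = (\<Sum>j\<in>UNIV. (- c $ j) * (x $ j - fst q $ j))"
    unfolding g_def by (rule sum.reindex_bij_betw[OF e])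
  also have "\<dots> = c \<bullet> fst q - c \<bullet> x"
    by (simp add: inner_vec_def algebra_simps sum_subtractf)
  finally have "a \<bullet> q \<le> a \<bullet> (x, y)"
    using snd_q by (simp add: inner_prod_def c_def)
  then show False
    using ab(1) ab(2)[OF \<open>q \<in> linking_polyhedron\<close>] by simp
qed

lemma linking_polyhedron_eq:
  "(linking_polyhedron :: ((real ^ 'a::finite) \<times> (real ^ 'a level)) set) =
      {(x, y). (\<Sum>j\<in>UNIV. x $ j) = (\<Sum>k=1..CARD('a). real k * yc y k)
        \<and> (\<forall>T. T \<noteq> {} \<and> T \<subset> UNIV \<longrightarrow> subset_form T x y \<le> 0)
        \<and> (\<Sum>k=1..CARD('a). yc y k) \<le> 1
        \<and> (\<forall>k\<in>{1..CARD('a)}. yc y k \<ge> 0)}" (is "_ = ?R")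
proof (intro equalityI subsetI)
  fix p :: "(real ^ 'a) \<times> (real ^ 'a level)"
  assume "p \<in> linking_polyhedron"
  from linking_polyhedron_valid[OF this] show "p \<in> ?R"
    by (auto simp: cardinality_form_def case_prod_beta)
next
  fix p :: "(real ^ 'a) \<times> (real ^ 'a level)"
  assume "p \<in> ?R"
  then show "p \<in> linking_polyhedron"
    by (cases p) (auto intro!: linking_polyhedronI simp: cardinality_form_def)
qed

section \<open>Spanning the equality hyperplane\<close>

text \<open>Exchanging one element keeps the cardinality, hence the \<open>y\<close>-part.\<close>

lemma diff_in_span_vertices:
  fixes i j :: "'a::finite"
  assumes "insert i B \<in> \<A>" "insert j B \<in> \<A>" "i \<notin> B" "j \<notin> B"
  shows "(axis i 1 - axis j 1, 0) \<in> span (vertex ` \<A>)"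
proof -
  have "(axis i 1 - axis j 1, 0) = vertex (insert i B) - vertex (insert j B)"
    using assms(3,4) by (auto simp: vertex_def vec_eq_iff axis_def)
  also have "\<dots> \<in> span (vertex ` \<A>)"
    using assms(1,2) by (intro span_diff span_base imageI)
  finally show ?thesis .
qed

text \<open>
  Subtracting \<open>y\<^sub>k\<close> times the chosen vertex of each level \<open>k\<close> clears the \<open>y\<close>-part and leaves \<open>(z, 0)\<close> where
  the entries of \<open>z\<close> sum to 0; such \<open>z\<close> are combinations of the differences of unit vectors.
\<close>

lemma cardinality_hyperplane_subset_span:
  fixes \<A> :: "'a::finite set set"
  assumes diff: "\<And>i j. (axis i 1 - axis j 1, 0) \<in> span (vertex ` \<A>)"
    and level: "\<And>k. k \<in> {1..CARD('a)} \<Longrightarrow> \<exists>A \<in> \<A>. card A = k"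
  shows "{p. cardinality_form p = 0} \<subseteq> span (vertex ` \<A>)"
proof clarify
  fix x :: "real ^ 'a" and y :: "real ^ 'a level"
  assume eq: "cardinality_form (x, y) = 0"
  obtain A where A: "\<And>k. k \<in> {1..CARD('a)} \<Longrightarrow> A k \<in> \<A> \<and> card (A k) = k"
    using level by metis
  define s where "s = (\<Sum>k=1..CARD('a). yc y k *\<^sub>R vertex (A k))"
  define z where "z = x - fst s"
  have s_span: "s \<in> span (vertex ` \<A>)"
    unfolding s_def using A by (intro span_sum span_scale span_base) auto
  have snd_s: "snd s = y"
  proof (rule yc_ext)
    fix k assume k: "k \<in> {1..CARD('a)}"
    have "yc (snd s) k = (\<Sum>m=1..CARD('a). yc y m * yc (snd (vertex (A m))) k)"
      by (simp add: s_def snd_sum)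
    also have "\<dots> = (\<Sum>m=1..CARD('a). if m = k then yc y m else 0)"
      using k A by (intro sum.cong) (auto simp: yc_vertex)
    also have "\<dots> = yc y k" using k by simp
    finally show "yc (snd s) k = yc y k" .
  qed
  have "cardinality_form s = 0"
    unfolding s_def
    by (simp add: linear_sum[OF linear_cardinality_form] linear_scale[OF linear_cardinality_form]
        cardinality_form_vertex)
  then have z0: "(\<Sum>j\<in>UNIV. z $ j) = 0"
    using eq by (simp add: cardinality_form_def snd_s z_def sum_subtractf)
  \<comment> \<open>Any index can serve as the common second element of the differences.\<close>
  fix i :: 'a
  have "(\<Sum>j\<in>UNIV. z $ j *\<^sub>R (axis j 1 - axis i 1)) = z"
  proof (simp add: vec_eq_iff, intro allI)
    fix m
    have "(\<Sum>j\<in>UNIV. z $ j * (axis j 1 $ m - axis i 1 $ m))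
        = (\<Sum>j\<in>UNIV. z $ j * axis j 1 $ m) - (\<Sum>j\<in>UNIV. z $ j) * axis i 1 $ m"
      by (simp add: right_diff_distrib sum_subtractf sum_distrib_right)
    also have "(\<Sum>j\<in>UNIV. z $ j * axis j 1 $ m) = (\<Sum>j\<in>UNIV. if j = m then z $ j else 0)"
      by (intro sum.cong) (auto simp: axis_def)
    finally show "(\<Sum>j\<in>UNIV. z $ j * (axis j 1 $ m - axis i 1 $ m)) = z $ m"
      using z0 by simp
  qed
  then have "(z, 0) = (\<Sum>j\<in>UNIV. z $ j *\<^sub>R (axis j 1 - axis i 1, 0 :: real ^ 'a level))"
    by (intro prod_eqI) (simp_all add: fst_sum snd_sum)
  also have "\<dots> \<in> span (vertex ` \<A>)"
    by (intro span_sum span_scale diff)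
  finally have "(z, 0) + s \<in> span (vertex ` \<A>)"
    using s_span by (rule span_add)
  moreover have "(z, 0) + s = (x, y)"
    by (intro prod_eqI) (simp_all add: z_def snd_s)
  ultimately show "(x, y) \<in> span (vertex ` \<A>)" by simp
qed

lemma affine_hull_linking_polyhedron:
  "affine hull linking_polyhedron = {p :: (real ^ 'a::finite) \<times> (real ^ 'a level). cardinality_form p = 0}"
proof (intro equalityI)
  have "affine {p :: (real ^ 'a) \<times> (real ^ 'a level). cardinality_form p = 0}"
    using linear_subspace_kernel[OF linear_cardinality_form] by (rule subspace_imp_affine)
  then show "affine hull linking_polyhedron
      \<subseteq> {p :: (real ^ 'a) \<times> (real ^ 'a level). cardinality_form p = 0}"
    using linking_polyhedron_valid(1) by (intro hull_minimal) auto
  have "0 \<in> affine hull (linking_polyhedron :: ((real ^ 'a) \<times> (real ^ 'a level)) set)"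
    by (metis hull_inc vertex_empty vertex_in_linking_polyhedron)
  then have span: "affine hull (linking_polyhedron :: ((real ^ 'a) \<times> (real ^ 'a level)) set)
      = span linking_polyhedron"
    by (rule affine_hull_span_0)
  have "{p. cardinality_form p = 0} \<subseteq> span (vertex ` (UNIV :: 'a set set))"
  proof (rule cardinality_hyperplane_subset_span)
    show "(axis i 1 - axis j 1, 0) \<in> span (range vertex)" for i j :: 'a
      by (rule diff_in_span_vertices[of _ "{}"]) auto
    show "\<exists>A \<in> (UNIV :: 'a set set). card A = k" if "k \<in> {1..CARD('a)}" for k
      using obtain_subset_with_card_n[of k "UNIV :: 'a set"] that by auto
  qed
  also have "\<dots> \<subseteq> span linking_polyhedron"
    using vertex_in_linking_polyhedron by (intro span_mono) auto
  finally show "{p :: (real ^ 'a) \<times> (real ^ 'a level). cardinality_form p = 0}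
      \<subseteq> affine hull linking_polyhedron"
    by (simp add: span)
qed

section \<open>The facets of the linking polyhedron\<close>

lemma convex_linking_polyhedron: "convex linking_polyhedron"
  using polytope_linking_polyhedron by (rule polytope_imp_convex)

text \<open>
  The face of a homogeneous inequality contains the origin, so its affine hull is its linear span.  It
  therefore suffices that the tight vertices and one further vertex \<open>Q\<close> span the whole hyperplane.
\<close>

lemma homogeneous_facet_of_linking_polyhedron:
  fixes f :: "(real ^ 'a::finite) \<times> (real ^ 'a level) \<Rightarrow> real" and Q :: "'a set"
  defines "\<A> \<equiv> insert Q {A. f (vertex A) = 0}"
  assumes lin: "linear f" and valid: "\<And>A. f (vertex A) \<le> 0" and Q: "f (vertex Q) \<noteq> 0"
    and diff: "\<And>i j. (axis i 1 - axis j 1, 0) \<in> span (vertex ` \<A>)"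
    and level: "\<And>k. k \<in> {1..CARD('a)} \<Longrightarrow> \<exists>A \<in> \<A>. card A = k"
  shows "linking_polyhedron \<inter> {p. f p = 0} facet_of linking_polyhedron"
proof (rule tight_set_facet_of[OF convex_linking_polyhedron lin _ vertex_in_linking_polyhedron Q])
  let ?G = "linking_polyhedron \<inter> {p. f p = 0}"
  show "f p \<le> 0" if "p \<in> linking_polyhedron" for p
    using linking_polyhedron_le[OF lin valid that] .
  have 0: "0 \<in> ?G"
    using vertex_in_linking_polyhedron[of "{} :: 'a set"] linear_0[OF lin] by (simp add: vertex_empty)
  then show "?G \<noteq> {}" by blast
  have "0 \<in> affine hull (insert (vertex Q) ?G)"
    using 0 by (intro hull_inc) blast
  then have hull: "affine hull (insert (vertex Q) ?G) = span (insert (vertex Q) ?G)"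
    by (rule affine_hull_span_0)
  have "linking_polyhedron \<subseteq> {p :: (real ^ 'a) \<times> (real ^ 'a level). cardinality_form p = 0}"
    using linking_polyhedron_valid(1) by blast
  also have "\<dots> \<subseteq> span (vertex ` \<A>)"
    using diff level by (rule cardinality_hyperplane_subset_span)
  also have "\<dots> \<subseteq> span (insert (vertex Q) ?G)"
    using vertex_in_linking_polyhedron by (intro span_mono) (auto simp: \<A>_def)
  finally show "linking_polyhedron \<subseteq> affine hull (insert (vertex Q) ?G)"
    by (simp add: hull)
qed

text \<open>
  Singletons inside \<open>T\<close> and sets \<open>insert j T\<close> are tight, so exchanges within \<open>T\<close> and within its complement
  stay in the span of the face.  The extra vertex, a singleton outside \<open>T\<close>, provides one exchange
  between the two parts, which connects all of them.
\<close>

lemma subset_form_facet: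
  fixes T :: "'a::finite set"
  assumes T: "T \<noteq> {}" "T \<subset> UNIV"
  shows "linking_polyhedron \<inter> {p. subset_form T (fst p) (snd p) = 0} facet_of linking_polyhedron"
proof -
  obtain j\<^sub>0 where j\<^sub>0: "j\<^sub>0 \<notin> T" using T by blast
  have tight: "subset_form T (fst (vertex A)) (snd (vertex A)) = 0" if "A \<subseteq> T \<or> T \<subseteq> A" for A
    using that by (auto simp: subset_form_vertex Int_absorb1 Int_absorb2 card_mono min_absorb1 min_absorb2)
  let ?\<A> = "insert {j\<^sub>0} {A. subset_form T (fst (vertex A)) (snd (vertex A)) = 0}"
  show ?thesis
  proof (rule homogeneous_facet_of_linking_polyhedron[OF linear_subset_form, where Q = "{j\<^sub>0}"])
    show "subset_form T (fst (vertex A)) (snd (vertex A)) \<le> 0" for A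
      using vertex_in_linking_polyhedron by (rule linking_polyhedron_valid(2))
    have "card T > 0" using T(1) by (simp add: card_gt_0_iff)
    then show "subset_form T (fst (vertex {j\<^sub>0})) (snd (vertex {j\<^sub>0})) \<noteq> 0"
      using j\<^sub>0 by (simp add: subset_form_vertex)
    have base: "(axis i 1 - axis j\<^sub>0 1, 0) \<in> span (vertex ` ?\<A>)" for i
    proof (cases "i \<in> T")
      case True
      then show ?thesis by (intro diff_in_span_vertices[of _ "{}"]) (auto intro: tight)
    next
      case False
      then show ?thesis using j\<^sub>0 by (intro diff_in_span_vertices[of _ T]) (auto intro: tight)
    qed
    show "(axis i 1 - axis j 1, 0) \<in> span (vertex ` ?\<A>)" for i j
      using span_diff[OF base[of i] base[of j]] by simp
    show "\<exists>A \<in> ?\<A>. card A = k" if k: "k \<in> {1..CARD('a)}" for k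
    proof (cases "k \<le> card T")
      case True
      then obtain A where "A \<subseteq> T" "card A = k"
        by (rule obtain_subset_with_card_n)
      then show ?thesis using tight by auto
    next
      case False
      have "card (- T) = CARD('a) - card T" by (simp add: Compl_eq_Diff_UNIV card_Diff_subset)
      then have "k - card T \<le> card (- T)" using k by auto
      then obtain B where B: "B \<subseteq> - T" "card B = k - card T"
        by (rule obtain_subset_with_card_n)
      then have "card (T \<union> B) = k"
        using False by (subst card_Un_disjoint) auto
      then show ?thesis using tight[of "T \<union> B"] by auto
    qed
  qed
qed

text \<open>
  All vertices outside level \<open>k\<close> are tight.  Exchanges are available in every level \<open>1, \<dots>, n - 1\<close>, so one
  such level other than \<open>k\<close> is required; it is missing when \<open>n = 2\<close> and \<open>k = 1\<close>, the pair that
  \<open>nonneg_facet_indices\<close> leaves out.  For \<open>n = 1\<close> there is nothing to exchange.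
\<close>

lemma nonneg_facet:
  assumes k: "k \<in> nonneg_facet_indices CARD('a::finite)"
  shows "linking_polyhedron \<inter> {p :: (real ^ 'a) \<times> (real ^ 'a level). - yc (snd p) k = 0}
    facet_of linking_polyhedron"
proof -
  let ?n = "CARD('a)"
  have k_n: "k \<in> {1..?n}"
    using k by (auto simp: nonneg_facet_indices_def split: if_splits)
  then obtain Q :: "'a set" where Q: "card Q = k"
    using obtain_subset_with_card_n[of k "UNIV :: 'a set"] by auto
  have form: "- yc (snd (vertex A)) k = (if card A = k then - 1 else 0)" for A :: "'a set"
    using k_n by (auto simp: yc_vertex)
  let ?\<A> = "insert Q {A. - yc (snd (vertex A)) k = 0}"
  show ?thesis
  proof (rule homogeneous_facet_of_linking_polyhedron[OF linear_minus_yc, where Q = Q])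
    show "- yc (snd (vertex A)) k \<le> 0" for A :: "'a set"
      by (simp add: form)
    show "- yc (snd (vertex Q)) k \<noteq> 0"
      by (simp add: form Q)
    show "\<exists>A \<in> ?\<A>. card A = m" if m: "m \<in> {1..?n}" for m
    proof (cases "m = k")
      case False
      obtain A :: "'a set" where "card A = m"
        using obtain_subset_with_card_n[of m "UNIV :: 'a set"] m by auto
      then show ?thesis using False by (auto simp: form)
    qed (use Q in auto)
    fix i j :: 'a
    show "(axis i 1 - axis j 1, 0) \<in> span (vertex ` ?\<A>)"
    proof (cases "i = j")
      case True
      then show ?thesis using span_zero[of "vertex ` ?\<A>"] by (simp add: zero_prod_def)
    next
      case False
      then have "card {i, j} \<le> ?n" by (intro card_mono) auto
      then have n2: "?n \<ge> 2" using False by simp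
      have "\<exists>m. m \<noteq> k \<and> 1 \<le> m \<and> m < ?n"
      proof (cases "k = 1")
        case True
        then have "?n \<noteq> 2" using k by (auto simp: nonneg_facet_indices_def)
        then show ?thesis using True n2 by (intro exI[of _ 2]) auto
      qed (use n2 in auto)
      then obtain m where m: "m \<noteq> k" "1 \<le> m" "m < ?n" by blast
      have "card (- {i, j}) = ?n - 2"
        using False by (simp add: Compl_eq_Diff_UNIV card_Diff_subset)
      then have "m - 1 \<le> card (- {i, j})" using m by simp
      then obtain B where B: "B \<subseteq> - {i, j}" "card B = m - 1"
        by (rule obtain_subset_with_card_n)
      then have nin: "i \<notin> B" "j \<notin> B" by blast+
      have "card (insert i B) = m" "card (insert j B) = m"
        using nin B(2) m(2) by simp_all
      then have "insert i B \<in> ?\<A>" "insert j B \<in> ?\<A>"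
        using m(1) unfolding form by simp_all
      then show ?thesis
        using nin by (rule diff_in_span_vertices)
    qed
  qed
qed

text \<open>Every vertex except the origin is tight.\<close>

lemma sum_yc_facet:
  "linking_polyhedron \<inter> {p :: (real ^ 'a::finite) \<times> (real ^ 'a level). (\<Sum>k=1..CARD('a). yc (snd p) k) = 1}
    facet_of linking_polyhedron"
proof (rule tight_set_facet_of[OF convex_linking_polyhedron linear_sum_yc _ vertex_in_linking_polyhedron[of "{}"]])
  let ?G = "linking_polyhedron \<inter> {p :: (real ^ 'a) \<times> (real ^ 'a level). (\<Sum>k=1..CARD('a). yc (snd p) k) = 1}"
  have form: "(\<Sum>k=1..CARD('a). yc (snd (vertex A)) k) = (if A = {} then 0 else 1)" for A :: "'a set"
    using sum_yc_vertex[of "\<lambda>k. if k = 0 then 0 else 1" A] by (simp split: if_splits)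
  show "(\<Sum>k=1..CARD('a). yc (snd p) k) \<le> 1"
    if "p \<in> linking_polyhedron" for p :: "(real ^ 'a) \<times> (real ^ 'a level)"
    using that by (rule linking_polyhedron_valid(3))
  show "(\<Sum>k=1..CARD('a). yc (snd (vertex ({} :: 'a set))) k) \<noteq> 1"
    unfolding form by simp
  have sub: "linking_points \<subseteq> insert (vertex {}) ?G"
    using vertex_in_linking_polyhedron form by (auto simp: linking_points_eq)
  have "vertex (UNIV :: 'a set) \<in> ?G"
    using vertex_in_linking_polyhedron form by auto
  then show "?G \<noteq> {}" by blast
  show "linking_polyhedron \<subseteq> affine hull (insert (vertex {}) ?G)"
    unfolding linking_polyhedron_def
    using hull_mono[OF sub, of affine] convex_hull_subset_affine_hull[of linking_points]
    unfolding linking_polyhedron_def by blast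
qed

text \<open>
  In the exceptional case the inequality follows by adding those of the two singletons, so dropping it
  from the system leaves the polyhedron unchanged.
\<close>

lemma yc_1_nonneg_if_CARD_2:
  fixes x :: "real ^ 'a::finite" and y :: "real ^ 'a level"
  assumes n: "CARD('a) = 2" and eq: "cardinality_form (x, y) = 0"
    and T: "\<And>T. T \<noteq> {} \<Longrightarrow> T \<subset> UNIV \<Longrightarrow> subset_form T x y \<le> 0"
  shows "yc y 1 \<ge> 0"
proof -
  obtain i j :: 'a where ij: "UNIV = {i, j}" "i \<noteq> j"
    using n by (auto simp: card_2_iff)
  have lev: "{1..2::nat} = {1, 2}" by auto
  have "subset_form {i} x y \<le> 0" "subset_form {j} x y \<le> 0"
    using ij by (auto intro!: T)
  then have "x $ i \<le> yc y 1 + yc y 2" "x $ j \<le> yc y 1 + yc y 2"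
    unfolding subset_form_min n lev by simp_all
  moreover have "x $ i + x $ j = yc y 1 + 2 * yc y 2"
    using eq ij(2) unfolding cardinality_form_def n lev ij(1) by (simp add: numeral_2_eq_2)
  ultimately show ?thesis by linarith
qed

lemma facets_linking_polyhedron:
  "{F. F facet_of (linking_polyhedron :: ((real ^ 'a::finite) \<times> (real ^ 'a level)) set)} =
      {linking_polyhedron \<inter> {(x, y). subset_form T x y = 0} | T. T \<noteq> {} \<and> T \<subset> UNIV}
        \<union> {linking_polyhedron \<inter> {(x, y). (\<Sum>k=1..CARD('a). yc y k) = 1}}
        \<union> {linking_polyhedron \<inter> {(x, y). yc y k = 0} | k. k \<in> nonneg_facet_indices CARD('a)}"
proof -
  let ?V = "linking_polyhedron :: ((real ^ 'a) \<times> (real ^ 'a level)) set"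
  define S where "S = (\<lambda>T. (\<lambda>p :: (real ^ 'a) \<times> (real ^ 'a level). subset_form T (fst p) (snd p), 0 :: real))
    ` {T. T \<noteq> {} \<and> T \<subset> UNIV}"
  define K where "K = (\<lambda>k. (\<lambda>p :: (real ^ 'a) \<times> (real ^ 'a level). - yc (snd p) k, 0 :: real))
    ` nonneg_facet_indices CARD('a)"
  define L where "L = S \<union> {(\<lambda>p. \<Sum>k=1..CARD('a). yc (snd p) k, 1)} \<union> K"
  have "{F. F facet_of ?V} = (\<lambda>(f, b). ?V \<inter> {p. f p = b}) ` L"
  proof (rule facets_of_facet_system[OF convex_linking_polyhedron])
    show "finite L"
      by (auto simp: L_def S_def K_def nonneg_facet_indices_def)
    show "linear f" if "(f, b) \<in> L" for f b
      using that by (auto simp: L_def S_def K_def intro: linear_subset_form linear_sum_yc linear_minus_yc)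
    show "?V \<inter> {p. f p = b} facet_of ?V" if "(f, b) \<in> L" for f b
      using that unfolding L_def S_def K_def
      using subset_form_facet sum_yc_facet nonneg_facet by blast
    have L_le: "(\<forall>(f, b) \<in> L. f p \<le> b) \<longleftrightarrow>
        (\<forall>T. T \<noteq> {} \<and> T \<subset> UNIV \<longrightarrow> subset_form T (fst p) (snd p) \<le> 0)
        \<and> (\<Sum>k=1..CARD('a). yc (snd p) k) \<le> 1
        \<and> (\<forall>k \<in> nonneg_facet_indices CARD('a). yc (snd p) k \<ge> 0)" for p
      by (auto simp: L_def S_def K_def ball_Un)
    have nonneg: "yc y k \<ge> 0"
      if eq: "cardinality_form (x, y) = 0" and ineqs: "\<forall>(f, b) \<in> L. f (x, y) \<le> b"
        and k: "k \<in> {1..CARD('a)}" for x :: "real ^ 'a" and y k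
    proof (cases "k \<in> nonneg_facet_indices CARD('a)")
      case True
      then show ?thesis using ineqs unfolding L_le by simp
    next
      case False
      then have "CARD('a) = 2" "k = 1" using k by (auto simp: nonneg_facet_indices_def split: if_splits)
      moreover have "subset_form T x y \<le> 0" if "T \<noteq> {}" "T \<subset> UNIV" for T
        using ineqs that unfolding L_le by simp
      ultimately show ?thesis using yc_1_nonneg_if_CARD_2 eq by blast
    qed
    show "?V = affine hull ?V \<inter> {p. \<forall>(f, b) \<in> L. f p \<le> b}"
    proof (intro equalityI subsetI)
      fix p assume p: "p \<in> ?V"
      have "k \<in> {1..CARD('a)}" if "k \<in> nonneg_facet_indices CARD('a)" for k
        using that by (auto simp: nonneg_facet_indices_def split: if_splits)
      then show "p \<in> affine hull ?V \<inter> {p. \<forall>(f, b) \<in> L. f p \<le> b}"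
        using linking_polyhedron_valid[OF p] unfolding L_le
        by (simp add: affine_hull_linking_polyhedron L_le)
    next
      fix p assume "p \<in> affine hull ?V \<inter> {p. \<forall>(f, b) \<in> L. f p \<le> b}"
      then obtain x y where p: "p = (x, y)" and eq: "cardinality_form (x, y) = 0"
        and ineqs: "\<forall>(f, b) \<in> L. f (x, y) \<le> b"
        by (cases p) (simp add: affine_hull_linking_polyhedron)
      show "p \<in> ?V"
        unfolding p
      proof (rule linking_polyhedronI[OF eq])
        show "subset_form T x y \<le> 0" if "T \<noteq> {}" "T \<subset> UNIV" for T
          using ineqs that unfolding L_le by simp
        show "(\<Sum>k=1..CARD('a). yc y k) \<le> 1"
          using ineqs unfolding L_le by simp
      qed (rule nonneg[OF eq ineqs])
    qed
  qed
  also have "\<dots> = {?V \<inter> {p. subset_form T (fst p) (snd p) = 0} | T. T \<noteq> {} \<and> T \<subset> UNIV}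
      \<union> {?V \<inter> {p. (\<Sum>k=1..CARD('a). yc (snd p) k) = 1}}
      \<union> {?V \<inter> {p. - yc (snd p) k = 0} | k. k \<in> nonneg_facet_indices CARD('a)}"
    by (simp add: L_def S_def K_def image_Un image_image setcompr_eq_image)
  finally show ?thesis by (simp add: case_prod_unfold)
qed

theorem mainTheorem2:
  fixes V :: "((real ^ 'a::finite) \<times> (real ^ 'a level)) set"
  assumes "V = linking_polyhedron"
  shows "polytope V
    \<and> affine hull V =
      {(x, y). (\<Sum>j\<in>UNIV. x $ j) = (\<Sum>k=1..CARD('a). real k * yc y k)}
    \<and> V =
      {(x, y). (\<Sum>j\<in>UNIV. x $ j) = (\<Sum>k=1..CARD('a). real k * yc y k)
        \<and> (\<forall>T. T \<noteq> {} \<and> T \<subset> UNIV \<longrightarrow> subset_form T x y \<le> 0)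
        \<and> (\<Sum>k=1..CARD('a). yc y k) \<le> 1
        \<and> (\<forall>k\<in>{1..CARD('a)}. yc y k \<ge> 0)}
    \<and> {F. F facet_of V} =
      {V \<inter> {(x, y). subset_form T x y = 0} | T. T \<noteq> {} \<and> T \<subset> UNIV}
        \<union> {V \<inter> {(x, y). (\<Sum>k=1..CARD('a). yc y k) = 1}}
        \<union> {V \<inter> {(x, y). yc y k = 0} | k. k \<in> nonneg_facet_indices CARD('a)}"
proof -
  have hull: "affine hull linking_polyhedron =
      {(x :: real ^ 'a, y). (\<Sum>j\<in>UNIV. x $ j) = (\<Sum>k=1..CARD('a). real k * yc y k)}"
    by (simp add: affine_hull_linking_polyhedron cardinality_form_def case_prod_unfold)
  show ?thesis
    unfolding assms
    by (rule conjI[OF polytope_linking_polyhedron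
          conjI[OF hull conjI[OF linking_polyhedron_eq facets_linking_polyhedron]]])
qed

end
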